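(* Let $a>0$, $m\in\mathbb{N}$, $x\ge0$, and let $f\colon\mathbb{R}_+\to\mathbb{R}$ be a function satisfying the following assumptions for $k=0,\ldots,m$: (1) the function $t\mapsto\binom{x-t}{k}\,\Delta^{k+1}f(t+a-1)$ lies in $\mathrm{dom}\,\Sigma$; (2) the function $t\mapsto\binom{x-t+1}{k}\,\Delta^kf(t+a-1)$ lies in $\mathcal{D}^{p_k}\cap\mathcal{K}^{p_k}$ for some integer $p_k\ge1$. Then $$f(x+a)=\sum_{j=0}^m\binom{x}{j}\,\Delta^jf(a)+\Big[\Sigma_t\,\binom{x-t}{m}\,\Delta^{m+1}f(t+a-1)\Big]_{t=x+1}.$$
   Context: $\mathbb{N}$ is the set of nonnegative integers, $\mathbb{R}_+=(0,\infty)$, $\Delta f(x)=f(x+1)-f(x)$, and $\binom{x}{j}=x(x-1)\cdots(x-j+1)/j!$ for real $x$ and $j\in\mathbb{N}$. $\Delta^kf(t+a-1)$ denotes the value of $\Delta^kf$ at the point $t+a-1$. For an integer $p\ge -1$, a function $f$ on a real interval $I$ is $p$-convex if its divided difference $f[x_0,\dots,x_{p+1}]$ is $\ge 0$ at any $p+2$ pairwise distinct points of $I$, and $p$-concave if $-f$ is $p$-convex. For $p\in\mathbb{N}$, $\mathcal{D}^p$ is the set of functions $f\colon\mathbb{R}_+\to\mathbb{R}$ such that $\Delta^pf(n)\to0$ as the integer $n\to\infty$. For an integer $p\ge-1$, $\mathcal{K}^p$ is the set of functions $f\colon\mathbb{R}_+\to\mathbb{R}$ that are eventually $p$-convex or eventually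 $p$-concave (i.e. $p$-convex, or $p$-concave, on some half-line $(M,\infty)$). Definition of $\Sigma$ (known well-definedness): $\mathrm{dom}\,\Sigma=\bigcup_{p\ge0}(\mathcal{D}^p\cap\mathcal{K}^p)$. If $g\in\mathcal{D}^p\cap\mathcal{K}^p$, then $\Sigma g\colon\mathbb{R}_+\to\mathbb{R}$ is the unique solution $f\in\mathcal{K}^p$ of $\Delta f=g$ on $\mathbb{R}_+$ with $f(1)=0$; it is given by the pointwise limit $$\Sigma g(x)=\lim_{n\to\infty}\Big(\sum_{k=1}^{n-1}g(k)-\sum_{k=0}^{n-1}g(x+k)+\sum_{j=1}^p\binom{x}{j}\Delta^{j-1}g(n)\Big),$$ and it does not depend on the choice of $p$. The notation $[\Sigma_t\,h(t)]_{t=c}$ means $(\Sigma h)(c)$, where $h$ is the whole expression following $\Sigma_t$ viewed as a function of $t$ (with $x$ fixed). *)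

theory Defs
  imports Complex_Main "HOL-Library.FuncSet"
begin

text \<open>
  Functions on the positive reals are represented by total functions of type
  \<^typ>\<open>real \<Rightarrow> real\<close>. Membership in \<open>\<D> p\<close>, \<open>\<K> p\<close> and \<open>dom_\<Sigma>\<close> and the values of
  \<open>\<Sigma>\<^sub>+ g\<close> on the positive reals depend only on the values of the function at positive arguments.
\<close>

definition forward_diff :: "(real \<Rightarrow> real) \<Rightarrow> real \<Rightarrow> real" ("\<Delta>")
  where "\<Delta> f x = f (x + 1) - f x"

text \<open>
  The divided difference is symmetric in its nodes, so that it is a function of the finite set of
  (pairwise distinct) nodes. The two lemmas below are the usual recursive description.
\<close>

definition divided_difference :: "(real \<Rightarrow> real) \<Rightarrow> real set \<Rightarrow> real"
  where "divided_difference f S = (\<Sum>x\<in>S. f x / (\<Prod>y\<in>S - {x}. x - y))"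

lemma divided_difference_singleton: "divided_difference f {x} = f x"
  by (simp add: divided_difference_def)

lemma divided_difference_rec:
  assumes S: "finite S" "a \<notin> S" "b \<notin> S" and ab: "a \<noteq> b"
  shows "divided_difference f (insert a (insert b S)) =
    (divided_difference f (insert b S) - divided_difference f (insert a S)) / (b - a)"
proof -
  define P where "P x = (\<Prod>y\<in>S - {x}. x - y)" for x
  have P0: "P x \<noteq> 0" for x
    using S by (simp add: P_def)
  have rm: "insert a (insert b S) - {a} = insert b S" "insert a (insert b S) - {b} = insert a S"
    "insert a S - {a} = S" "insert b S - {b} = S" "S - {a} = S" "S - {b} = S"
    using S ab by auto
  have rmx: "insert a (insert b S) - {x} = insert a (insert b (S - {x}))"
    "insert a S - {x} = insert a (S - {x})" "insert b S - {x} = insert b (S - {x})"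
    "x \<noteq> a" "x \<noteq> b" if "x \<in> S" for x
    using S that by auto
  have L: "divided_difference f (insert a (insert b S)) =
      f a / ((a - b) * P a) + f b / ((b - a) * P b) + (\<Sum>x\<in>S. f x / ((x - a) * (x - b) * P x))"
    using S ab by (simp add: divided_difference_def rm rmx P_def mult.assoc)
  have A: "divided_difference f (insert a S) = f a / P a + (\<Sum>x\<in>S. f x / ((x - a) * P x))"
    using S ab by (simp add: divided_difference_def rm rmx P_def)
  have B: "divided_difference f (insert b S) = f b / P b + (\<Sum>x\<in>S. f x / ((x - b) * P x))"
    using S ab by (simp add: divided_difference_def rm rmx P_def)
  have *: "(\<Sum>x\<in>S. f x / ((x - b) * P x)) - (\<Sum>x\<in>S. f x / ((x - a) * P x)) =
      (\<Sum>x\<in>S. f x / ((x - a) * (x - b) * P x) * (b - a))"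
    unfolding sum_subtractf[symmetric]
  proof (rule sum.cong[OF refl])
    fix x assume "x \<in> S"
    then have "x - a \<noteq> 0" "x - b \<noteq> 0" using rmx(4,5) by auto
    then show "f x / ((x - b) * P x) - f x / ((x - a) * P x) =
        f x / ((x - a) * (x - b) * P x) * (b - a)"
      using P0[of x] by (simp add: divide_simps) (simp add: algebra_simps)
  qed
  have alg: "u / ((a - b) * p) + v / ((b - a) * q) + W = ((v / q + V) - (u / p + U)) / (b - a)"
    if "V - U = W * (b - a)" "p \<noteq> 0" "q \<noteq> 0" for u v p q U V W :: real
  proof -
    have W: "W = (V - U) / (b - a)" using that ab by simp
    have u: "u / ((a - b) * p) = - (u / p) / (b - a)"
      using that(2) ab by (simp add: divide_simps) (simp add: algebra_simps)
    have v: "v / ((b - a) * q) = (v / q) / (b - a)" by simp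
    show ?thesis unfolding W u v by (simp add: add_divide_distrib diff_divide_distrib)
  qed
  show ?thesis
    unfolding L A B using * P0 by (intro alg) (simp_all add: sum_distrib_right)
qed

definition p_convex_on :: "nat \<Rightarrow> real set \<Rightarrow> (real \<Rightarrow> real) \<Rightarrow> bool"
  where "p_convex_on p I f \<longleftrightarrow>
    (\<forall>S. finite S \<and> card S = p + 2 \<and> S \<subseteq> I \<longrightarrow> divided_difference f S \<ge> 0)"

definition p_concave_on :: "nat \<Rightarrow> real set \<Rightarrow> (real \<Rightarrow> real) \<Rightarrow> bool"
  where "p_concave_on p I f \<longleftrightarrow> p_convex_on p I (\<lambda>x. - f x)"

definition asymp_D :: "nat \<Rightarrow> (real \<Rightarrow> real) set" ("\<D>")
  where "\<D> p = {f. (\<lambda>n. (\<Delta> ^^ p) f (real n)) \<longlonglongrightarrow> 0}"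

definition asymp_K :: "nat \<Rightarrow> (real \<Rightarrow> real) set" ("\<K>")
  where "\<K> p = {f. \<exists>M\<ge>0. p_convex_on p {M<..} f \<or> p_concave_on p {M<..} f}"

definition dom_Sigma :: "(real \<Rightarrow> real) set" ("dom'_\<Sigma>")
  where "dom_\<Sigma> = (\<Union>p. \<D> p \<inter> \<K> p)"

text \<open>
  For \<open>g \<in> dom_\<Sigma>\<close> the solution is unique as a function on the positive reals, and it is the same
  for all admissible \<open>p\<close>; \<^const>\<open>extensional\<close> fixes its values at the other arguments. The value
  of \<open>\<Sigma>\<^sub>+ g\<close> is irrelevant when \<open>g \<notin> dom_\<Sigma>\<close>.
\<close>

definition principal_sum :: "(real \<Rightarrow> real) \<Rightarrow> real \<Rightarrow> real" ("\<Sigma>\<^sub>+")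
  where "\<Sigma>\<^sub>+ g = (THE f. f \<in> extensional {0<..} \<and> f 1 = 0 \<and> (\<forall>x>0. \<Delta> f x = g x) \<and>
    (\<exists>p. g \<in> \<D> p \<inter> \<K> p \<and> f \<in> \<K> p))"

end

theory Submission
  imports Defs
begin

text \<open>
  Put \<open>h\<^sub>k(t) = (x - t + 1 gchoose k) \<Delta>\<^sup>k f(t + a - 1)\<close> and let \<open>g\<close> be the function whose
  principal sum is taken. By Pascal's rule the sum \<open>H = h\<^sub>0 + \<dots> + h\<^sub>m\<close> satisfies \<open>\<Delta> H = g\<close>
  (\<open>diff_newton_terms\<close>); moreover \<open>H(x + 1) = f(x + a)\<close>, because \<open>(0 gchoose k) = 0\<close> for
  \<open>k > 0\<close>, and \<open>H(1)\<close> is the Newton sum of the formula. So the claim is that the principal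
  sum of \<open>g\<close> is \<open>H - H(1)\<close>. The difficulty is that the summands \<open>h\<^sub>k\<close> lie in different classes
  \<open>\<K> p\<close>, some of them possibly convex and some concave, so that it is not evident that \<open>H\<close>, the sum,
  lies in any of these classes.

  This is resolved with the limit formula, which is linear in \<open>g\<close>. Its approximations
  (\<open>sum_approx\<close>) converge to \<open>F(y) - F(1)\<close> when they are formed for \<open>\<Delta> F\<close> with \<open>F \<in> \<K> p\<close> and
  \<open>\<Delta>\<^sup>p\<^sup>+\<^sup>1 F(n) \<rightarrow> 0\<close> (\<open>sum_approx_diff_tendsto\<close>): the error is the remainder of Newton interpolation
  of \<open>F\<close> at \<open>n, \<dots>, n + p\<close>, and convexity bounds it by an increment of \<open>\<Delta>\<^sup>p F\<close>
  (\<open>newton_remainder_bound\<close>). This applies to each \<open>h\<^sub>k\<close> separately. Raising the order changes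
  the approximations only by a null sequence (\<open>sum_approx_order\<close>), so the limits can be added, and
  the approximations for \<open>g\<close> converge to \<open>H - H(1)\<close>. But then \<open>H - H(1)\<close> is a limit of
  functions that are \<open>p\<close>-concave where \<open>g\<close> is \<open>p\<close>-convex, and vice versa
  (\<open>sum_approx_limit_K\<close>); so it lies in \<open>\<K> p\<close> after all. Since every other solution in such a
  class is given by the same limit, it is the principal sum (\<open>principal_sum_eqI\<close>).
\<close>

section \<open>Forward differences\<close>

lemma diff_add: "\<Delta> (\<lambda>x. f x + g x) x = \<Delta> f x + \<Delta> g x"
  by (simp add: forward_diff_def)

lemma iterated_diff_Suc: "(\<Delta> ^^ Suc j) f x = (\<Delta> ^^ j) f (x + 1) - (\<Delta> ^^ j) f x"
  by (simp add: forward_diff_def)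

lemma iterated_diff_diff: "(\<Delta> ^^ j) (\<Delta> f) = (\<Delta> ^^ Suc j) f"
  by (simp add: funpow_swap1)

lemma iterated_diff_cong:
  assumes "\<And>x. x > 0 \<Longrightarrow> u x = v x" and "x > 0"
  shows "(\<Delta> ^^ j) u x = (\<Delta> ^^ j) v x"
  using assms(2)
  by (induction j arbitrary: x) (simp_all add: assms(1) forward_diff_def)

lemma iterated_diff_uminus: "(\<Delta> ^^ j) (\<lambda>x. - f x) x = - (\<Delta> ^^ j) f x"
  by (induction j arbitrary: x) (simp_all add: forward_diff_def)

lemma iterated_diff_sum:
  "(\<Delta> ^^ j) (\<lambda>x. \<Sum>k\<in>A. u k x) x = (\<Sum>k\<in>A. (\<Delta> ^^ j) (u k) x)"
  by (induction j arbitrary: x) (simp_all add: forward_diff_def sum_subtractf)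

lemma iterated_diff_tendsto_mono:
  assumes "(\<lambda>n. (\<Delta> ^^ p) f (real n)) \<longlonglongrightarrow> 0" and "p \<le> q"
  shows "(\<lambda>n. (\<Delta> ^^ q) f (real n)) \<longlonglongrightarrow> 0"
  using assms(2)
proof (induction q rule: dec_induct)
  case base
  show ?case by (rule assms(1))
next
  case (step q)
  have "(\<lambda>n. (\<Delta> ^^ q) f (real (Suc n)) - (\<Delta> ^^ q) f (real n)) \<longlonglongrightarrow> 0 - 0"
    by (intro tendsto_diff step.IH LIMSEQ_Suc[OF step.IH])
  then show ?case
    by (simp add: iterated_diff_Suc add.commute del: funpow.simps)
qed

lemma iterated_diff_increment_tendsto:
  assumes "(\<lambda>n. (\<Delta> ^^ Suc p) f (real n)) \<longlonglongrightarrow> 0"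
  shows "(\<lambda>n. (\<Delta> ^^ p) f (real n + real N) - (\<Delta> ^^ p) f (real n)) \<longlonglongrightarrow> 0"
proof -
  have "(\<Delta> ^^ p) f (real n + real N) - (\<Delta> ^^ p) f (real n)
      = (\<Sum>i<N. (\<Delta> ^^ Suc p) f (real (n + i)))" for n
    by (induction N) (simp_all add: iterated_diff_Suc algebra_simps del: funpow.simps)
  moreover have "(\<lambda>n. \<Sum>i<N. (\<Delta> ^^ Suc p) f (real (n + i))) \<longlonglongrightarrow> (\<Sum>i<N. 0)"
    by (intro tendsto_sum LIMSEQ_ignore_initial_segment assms)
  ultimately show ?thesis by simp
qed

section \<open>Divided differences\<close>

lemma divided_difference_uminus:
  "divided_difference (\<lambda>x. - f x) S = - divided_difference f S"
  by (simp add: divided_difference_def sum_negf)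

lemma divided_difference_diff:
  "divided_difference (\<lambda>x. f x - g x) S = divided_difference f S - divided_difference g S"
  by (simp add: divided_difference_def diff_divide_distrib sum_subtractf)

lemma divided_difference_add:
  "divided_difference (\<lambda>x. f x + g x) S = divided_difference f S + divided_difference g S"
  by (simp add: divided_difference_def add_divide_distrib sum.distrib)

lemma divided_difference_cmult:
  "divided_difference (\<lambda>x. c * f x) S = c * divided_difference f S"
  by (simp add: divided_difference_def sum_distrib_left)

lemma divided_difference_sum:
  "divided_difference (\<lambda>x. \<Sum>k\<in>A. f k x) S = (\<Sum>k\<in>A. divided_difference (f k) S)"
  unfolding divided_difference_def sum_divide_distrib by (rule sum.swap)

lemma divided_difference_shift:
  "divided_difference (\<lambda>x. f (x + c)) S = divided_difference f ((\<lambda>x. x + c) ` S)"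
proof -
  have "(\<Prod>y\<in>(\<lambda>x. x + c) ` S - {x + c}. x + c - y) = (\<Prod>y\<in>S - {x}. x - y)" for x
  proof -
    have "(\<lambda>x. x + c) ` S - {x + c} = (\<lambda>x. x + c) ` (S - {x})" by auto
    then show ?thesis by (simp add: prod.reindex)
  qed
  then show ?thesis
    unfolding divided_difference_def by (subst sum.reindex) auto
qed

lemma divided_difference_tendsto:
  assumes "\<And>x. x \<in> S \<Longrightarrow> (\<lambda>n. F n x) \<longlonglongrightarrow> f x"
  shows "(\<lambda>n. divided_difference (F n) S) \<longlonglongrightarrow> divided_difference f S"
  unfolding divided_difference_def divide_inverse
  by (intro tendsto_sum tendsto_mult_right assms)

lemma divided_difference_const:
  assumes "finite S" and "card S \<ge> 2"
  shows "divided_difference (\<lambda>x. c) S = 0"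
  using assms
proof (induction "card S" arbitrary: S rule: less_induct)
  case less
  obtain a b R where S: "S = insert a (insert b R)" "a \<noteq> b" "a \<notin> R" "b \<notin> R"
  proof -
    obtain T where "T \<subseteq> S" "card T = 2" using obtain_subset_with_card_n[OF less.prems(2)] by blast
    then obtain a b where "a \<in> S" "b \<in> S" "a \<noteq> b" by (auto simp: card_2_iff)
    then show thesis using that[of a b "S - {a, b}"] by auto
  qed
  have R: "finite R" using less.prems(1) S by simp
  have "divided_difference (\<lambda>x. c) (insert a R) = divided_difference (\<lambda>x. c) (insert b R)"
  proof (cases "R = {}")
    case True
    then show ?thesis by (simp add: divided_difference_singleton)
  next
    case False
    then have "card R \<ge> 1" using R by (simp add: Suc_le_eq card_gt_0_iff)
    then show ?thesis
      using less.hyps[of "insert a R"] less.hyps[of "insert b R"] S R by simp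
  qed
  then show ?case
    unfolding S(1) using divided_difference_rec[of R a b] S R by simp
qed

text \<open>The linear factor cancels against the factor of the node \<open>c\<close> in every denominator.\<close>

lemma divided_difference_linear_factor:
  assumes "finite S" and "c \<in> S"
  shows "divided_difference (\<lambda>x. (x - c) * q x) S = divided_difference q (S - {c})"
proof -
  have "(x - c) * q x / (\<Prod>y\<in>S - {x}. x - y) = q x / (\<Prod>y\<in>S - {c} - {x}. x - y)"
    if "x \<in> S - {c}" for x
  proof -
    have "S - {x} = insert c (S - {c} - {x})" using that assms by auto
    then show ?thesis using that assms by (simp add: divide_simps)
  qed
  then show ?thesis
    unfolding divided_difference_def sum.remove[OF assms] by simp
qed

text \<open>A factor \<open>x - c\<close> is split as \<open>(x - s) + (s - c)\<close> with a node \<open>s\<close>, so that each factor uses up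
  at most one node.\<close>

lemma divided_difference_prod:
  assumes "finite S" and "card S \<ge> j + 2"
  shows "divided_difference (\<lambda>x. \<Prod>i<j. x - c i) S = 0"
  using assms
proof (induction j arbitrary: S)
  case 0
  then show ?case by (simp add: divided_difference_const)
next
  case (Suc j)
  obtain s where s: "s \<in> S" using Suc.prems by fastforce
  let ?q = "\<lambda>x. \<Prod>i<j. x - c i"
  have "(\<lambda>x. \<Prod>i<Suc j. x - c i) = (\<lambda>x. (x - s) * ?q x + (s - c j) * ?q x)"
    by (simp add: algebra_simps)
  then have "divided_difference (\<lambda>x. \<Prod>i<Suc j. x - c i) S =
      divided_difference ?q (S - {s}) + (s - c j) * divided_difference ?q S"
    using s Suc.prems(1)
    by (simp only: divided_difference_add divided_difference_cmult divided_difference_linear_factor)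
  also have "\<dots> = 0"
    using Suc.IH[of "S - {s}"] Suc.IH[of S] Suc.prems s by simp
  finally show ?case .
qed

lemma gchoose_eq_prod: "(x::real) gchoose j = (\<Prod>i<j. x - real i) / fact j"
  by (simp add: gbinomial_prod_rev atLeast0LessThan)

lemma divided_difference_gchoose:
  assumes "finite S" and "card S \<ge> j + 2"
  shows "divided_difference (\<lambda>x. (x gchoose j) * c) S = 0"
proof -
  have "(\<lambda>x::real. (x gchoose j) * c) = (\<lambda>x. (c / fact j) * (\<Prod>i<j. x - real i))"
    by (simp add: gchoose_eq_prod mult.commute)
  then show ?thesis
    by (simp only: divided_difference_cmult divided_difference_prod[OF assms, of real] mult_zero_right)
qed

lemma divided_difference_node_mono:
  assumes "p_convex_on p I f" and "finite S" "card S = p" "S \<subseteq> I"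
    and "a \<in> I" "b \<in> I" "a < b" "a \<notin> S" "b \<notin> S"
  shows "divided_difference f (insert a S) \<le> divided_difference f (insert b S)"
proof -
  have "0 \<le> divided_difference f (insert a (insert b S))"
    using assms unfolding p_convex_on_def by auto
  also have "\<dots> = (divided_difference f (insert b S) - divided_difference f (insert a S)) / (b - a)"
    by (rule divided_difference_rec) (use assms in auto)
  finally show ?thesis
    using \<open>a < b\<close> by (simp add: zero_le_divide_iff)
qed

section \<open>Interpolation on an equidistant grid\<close>

definition grid :: "real \<Rightarrow> nat \<Rightarrow> real set"
  where "grid c p = (\<lambda>i. c + real i) ` {..<p}"

lemma finite_grid: "finite (grid c p)"
  by (simp add: grid_def)

lemma card_grid: "card (grid c p) = p"
  unfolding grid_def by (subst card_image) (auto simp: inj_on_def)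

lemma grid_0: "grid c 0 = {}"
  by (simp add: grid_def)

lemma grid_Suc: "grid c (Suc p) = insert (c + real p) (grid c p)"
  by (auto simp: grid_def lessThan_Suc)

lemma grid_Suc_left: "grid c (Suc p) = insert c (grid (c + 1) p)"
  by (simp add: grid_def lessThan_Suc_eq_insert_0 image_image add.assoc)

lemma grid_notin: "c + real p \<notin> grid c p" "c \<notin> grid (c + 1) p"
  by (auto simp: grid_def)

lemma divided_difference_grid:
  "divided_difference f (grid c (Suc p)) = (\<Delta> ^^ p) f c / fact p"
proof (induction p arbitrary: c)
  case 0
  show ?case by (simp add: grid_Suc grid_0 divided_difference_singleton)
next
  case (Suc p)
  let ?G = "grid (c + 1) p"
  have "divided_difference f (grid c (Suc (Suc p)))
      = divided_difference f (insert c (insert (c + 1 + real p) ?G))"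
    by (simp only: grid_Suc_left[of c] grid_Suc[of "c + 1"])
  also have "\<dots> = (divided_difference f (insert (c + 1 + real p) ?G)
      - divided_difference f (insert c ?G)) / (c + 1 + real p - c)"
    by (rule divided_difference_rec) (use grid_notin[of "c + 1" p] grid_notin[of c p] in
      \<open>auto simp: finite_grid\<close>)
  also have "\<dots> = ((\<Delta> ^^ p) f (c + 1) / fact p - (\<Delta> ^^ p) f c / fact p) / (1 + real p)"
    by (simp add: Suc.IH flip: grid_Suc grid_Suc_left)
  also have "\<dots> = (\<Delta> ^^ Suc p) f c / fact (Suc p)"
    by (simp add: forward_diff_def divide_simps)
  finally show ?case .
qed

text \<open>Newton's form of the interpolating polynomial, with its remainder.\<close>

lemma newton_remainder:
  assumes "\<And>i. x \<noteq> real i"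
  shows "f (c + x) - (\<Sum>j<p. (x gchoose j) * (\<Delta> ^^ j) f c) =
    (\<Prod>i<p. x - real i) * divided_difference f (insert (c + x) (grid c p))"
proof (induction p)
  case 0
  show ?case by (simp add: grid_0 divided_difference_singleton)
next
  case (Suc p)
  let ?G = "grid c p"
  have "c + x \<notin> ?G" using assms by (auto simp: grid_def)
  then have "divided_difference f (insert (c + real p) (insert (c + x) ?G)) =
      (divided_difference f (insert (c + x) ?G) - divided_difference f (insert (c + real p) ?G))
        / (c + x - (c + real p))"
    by (intro divided_difference_rec) (use assms[of p] grid_notin[of c p] in \<open>auto simp: finite_grid\<close>)
  moreover have "insert (c + x) (grid c (Suc p)) = insert (c + real p) (insert (c + x) ?G)"
    by (auto simp: grid_Suc)
  ultimately have "(x - real p) * divided_difference f (insert (c + x) (grid c (Suc p))) =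
      divided_difference f (insert (c + x) ?G) - (\<Delta> ^^ p) f c / fact p"
    using assms[of p] by (simp flip: grid_Suc add: divided_difference_grid)
  then have "(\<Prod>i<Suc p. x - real i) * divided_difference f (insert (c + x) (grid c (Suc p))) =
      (\<Prod>i<p. x - real i) * divided_difference f (insert (c + x) ?G) - (x gchoose p) * (\<Delta> ^^ p) f c"
    by (simp only: prod.lessThan_Suc mult.assoc) (simp add: gchoose_eq_prod right_diff_distrib)
  then show ?case by (simp flip: Suc.IH)
qed

lemma newton_nat:
  "f (c + real N) = (\<Sum>j\<le>N. (real N gchoose j) * (\<Delta> ^^ j) f c)"
proof (induction N arbitrary: c)
  case 0
  show ?case by simp
next
  case (Suc N)
  have *: "(\<Sum>j\<le>N. (real N gchoose j) * (\<Delta> ^^ j) f c)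
      = (\<Sum>j\<le>Suc N. (real N gchoose j) * (\<Delta> ^^ j) f c)"
    by (simp add: binomial_gbinomial[symmetric])
  have "f (c + real (Suc N)) = (\<Sum>j\<le>N. (real N gchoose j) * (\<Delta> ^^ j) f (c + 1))"
    using Suc.IH[of "c + 1"] by (simp add: algebra_simps)
  also have "\<dots> = (\<Sum>j\<le>N. (real N gchoose j) * (\<Delta> ^^ j) f c)
      + (\<Sum>j\<le>N. (real N gchoose j) * (\<Delta> ^^ Suc j) f c)"
    by (simp add: iterated_diff_Suc right_diff_distrib sum_subtractf del: funpow.simps)
  also have "\<dots> = (\<Sum>j\<le>Suc N. (real (Suc N) gchoose j) * (\<Delta> ^^ j) f c)"
    unfolding * sum.atMost_Suc_shift
    by (simp add: gbinomial_Suc_Suc add.commute[of 1] distrib_right sum.distrib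
        del: funpow.simps sum.atMost_Suc)
  finally show ?case .
qed

text \<open>Up to a factor that depends on \<open>x\<close> only, the remainder lies between \<open>0\<close> and an increment
  of \<open>\<Delta>\<^sup>p f\<close>: a divided difference
  of order \<open>p\<close> of a \<open>p\<close>-convex function increases with each of its nodes, so moving the grid to
  the right past the point \<open>c + x\<close>, and then the point \<open>c + x\<close> to the end of the moved grid,
  gives the upper bound.\<close>

lemma newton_remainder_bound:
  assumes conv: "p_convex_on p {M<..} f" and c: "c > M" and x: "x > 0" "\<And>i. x \<noteq> real i"
    and N: "x < real (Suc N)"
  shows "\<bar>f (c + x) - (\<Sum>j\<le>p. (x gchoose j) * (\<Delta> ^^ j) f c)\<bar> \<le>
    \<bar>\<Prod>i<p. x - 1 - real i\<bar> * (((\<Delta> ^^ p) f (c + real (Suc N)) - (\<Delta> ^^ p) f c) / fact p)"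
proof -
  define z where "z = c + x"
  define G where "G = (\<lambda>i. grid (c + real i) p)"
  have G_sub: "G i \<subseteq> {M<..}" for i using c by (auto simp: G_def grid_def)
  have finG: "finite (G i)" for i by (simp add: G_def finite_grid)
  have cardG: "card (G i) = p" for i by (simp add: G_def card_grid)
  have z_notin: "z \<notin> G i" for i
  proof
    assume "z \<in> G i"
    then obtain k where "c + x = c + real i + real k" by (auto simp: z_def G_def grid_def)
    then show False using x(2)[of "i + k"] by simp
  qed
  have z_gt: "z > M" using c x by (simp add: z_def)
  have GS: "grid (c + real i) (Suc p) = insert (c + real i) (G (Suc i))" for i
    by (simp add: G_def grid_Suc_left add.assoc add.commute[of 1])
  have step: "divided_difference f (insert z (G i)) \<le> divided_difference f (insert z (G (Suc i)))" for i
  proof (cases p)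
    case 0
    then show ?thesis by (simp add: G_def grid_0)
  next
    case (Suc q)
    define S where "S = insert z (grid (c + real i + 1) q)"
    let ?a = "c + real i" and ?b = "c + real i + 1 + real q"
    have a: "insert z (G i) = insert ?a S"
      by (auto simp: G_def Suc S_def grid_Suc_left)
    have b: "insert z (G (Suc i)) = insert ?b S"
      by (auto simp: G_def Suc S_def grid_Suc algebra_simps)
    have zn: "z \<notin> grid (c + real i + 1) q"
      using z_notin[of i] by (simp add: G_def Suc grid_Suc_left)
    have za: "z \<noteq> ?a" using z_notin[of i] by (simp add: G_def Suc grid_Suc_left)
    have zb: "z \<noteq> ?b" using z_notin[of "Suc i"] by (simp add: G_def Suc grid_Suc algebra_simps)
    show ?thesis
      unfolding a b
    proof (rule divided_difference_node_mono[OF conv])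
      show "finite S" by (simp add: S_def finite_grid)
      show "card S = p" using zn by (simp add: S_def finite_grid card_grid Suc)
      show "S \<subseteq> {M<..}" using z_gt c by (auto simp: S_def grid_def)
      show "?a \<notin> S" using za grid_notin(2)[of ?a q] by (auto simp: S_def)
      show "?b \<notin> S" using zb grid_notin(1)[of "?a + 1" q] by (auto simp: S_def)
    qed (use c in auto)
  qed
  have end_notin: "c + real (Suc N) + real p \<notin> G (Suc N)"
    unfolding G_def by (rule grid_notin)
  have "divided_difference f (insert z (G 1)) \<le> divided_difference f (insert z (G (Suc N)))"
    using lift_Suc_mono_le[of "\<lambda>i. divided_difference f (insert z (G i))" 1 "Suc N"] step by simp
  also have "\<dots> \<le> divided_difference f (insert (c + real (Suc N) + real p) (G (Suc N)))"
    by (rule divided_difference_node_mono[OF conv])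
      (use finG cardG G_sub z_gt z_notin N c end_notin
        in \<open>auto simp: z_def simp del: of_nat_Suc\<close>)
  also have "\<dots> = (\<Delta> ^^ p) f (c + real (Suc N)) / fact p"
    by (simp add: G_def divided_difference_grid flip: grid_Suc)
  finally have upper: "divided_difference f (insert z (G 1)) \<le> (\<Delta> ^^ p) f (c + real (Suc N)) / fact p" .
  have c_notin: "c \<notin> G 1" using grid_notin(2)[of c p] by (simp add: G_def)
  have at_c: "divided_difference f (insert c (G 1)) = (\<Delta> ^^ p) f c / fact p"
    using GS[of 0] by (simp flip: divided_difference_grid)
  have lower: "divided_difference f (insert c (G 1)) \<le> divided_difference f (insert z (G 1))"
    by (rule divided_difference_node_mono[OF conv])
      (use finG cardG G_sub z_gt z_notin c x c_notin in \<open>auto simp: z_def\<close>)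
  \<comment> \<open>The factor \<open>x\<close> of the Newton product turns the divided difference on \<open>p + 2\<close> nodes into a
    difference of two divided differences on \<open>p + 1\<close> nodes, to which the bounds apply.\<close>
  have "insert z (grid c (Suc p)) = insert c (insert z (G 1))"
    using GS[of 0] by auto
  moreover have "divided_difference f (insert c (insert z (G 1))) =
      (divided_difference f (insert z (G 1)) - divided_difference f (insert c (G 1))) / (z - c)"
    by (rule divided_difference_rec) (use finG c_notin z_notin x in \<open>auto simp: z_def\<close>)
  ultimately have dd: "x * divided_difference f (insert z (grid c (Suc p))) =
      divided_difference f (insert z (G 1)) - divided_difference f (insert c (G 1))"
    using x by (simp add: z_def)
  have "f z - (\<Sum>j\<le>p. (x gchoose j) * (\<Delta> ^^ j) f c) =
      (\<Prod>i<Suc p. x - real i) * divided_difference f (insert z (grid c (Suc p)))"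
    using newton_remainder[OF x(2), of f c "Suc p"] by (simp only: z_def lessThan_Suc_atMost)
  also have "(\<Prod>i<Suc p. x - real i) = x * (\<Prod>i<p. x - 1 - real i)"
    by (subst prod.lessThan_Suc_shift) (simp add: algebra_simps)
  also have "x * (\<Prod>i<p. x - 1 - real i) * divided_difference f (insert z (grid c (Suc p))) =
      (\<Prod>i<p. x - 1 - real i) *
        (divided_difference f (insert z (G 1)) - divided_difference f (insert c (G 1)))"
    unfolding dd[symmetric] by (simp only: ac_simps)
  finally have "\<bar>f z - (\<Sum>j\<le>p. (x gchoose j) * (\<Delta> ^^ j) f c)\<bar> = \<bar>\<Prod>i<p. x - 1 - real i\<bar> *
      (divided_difference f (insert z (G 1)) - divided_difference f (insert c (G 1)))"
    using lower by (simp add: abs_mult)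
  also have "\<dots> \<le> \<bar>\<Prod>i<p. x - 1 - real i\<bar> *
      (((\<Delta> ^^ p) f (c + real (Suc N)) - (\<Delta> ^^ p) f c) / fact p)"
    using upper at_c by (intro mult_left_mono) (simp_all add: diff_divide_distrib)
  finally show ?thesis by (simp add: z_def)
qed

text \<open>For integer \<open>x\<close> the points \<open>c + x\<close> may be nodes of the grid, and the finite expansion
  \<open>newton_nat\<close> takes the place of the bound.\<close>

lemma newton_remainder_tendsto_convex:
  assumes conv: "p_convex_on p {M<..} f"
    and lim: "(\<lambda>n. (\<Delta> ^^ Suc p) f (real n)) \<longlonglongrightarrow> 0" and x: "x > 0"
  shows "(\<lambda>n. f (real n + x) - (\<Sum>j\<le>p. (x gchoose j) * (\<Delta> ^^ j) f (real n))) \<longlonglongrightarrow> 0"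
proof (cases "\<exists>N. x = real N")
  case True
  then obtain N where N: "x = real N" by blast
  have "f (real n + x) - (\<Sum>j\<le>p. (x gchoose j) * (\<Delta> ^^ j) f (real n)) =
      (\<Sum>j\<in>{p<..N}. (x gchoose j) * (\<Delta> ^^ j) f (real n))" for n
  proof -
    have "(\<Sum>j\<le>N. (x gchoose j) * (\<Delta> ^^ j) f (real n))
        = (\<Sum>j\<le>max p N. (x gchoose j) * (\<Delta> ^^ j) f (real n))"
      by (rule sum.mono_neutral_left) (auto simp: N binomial_gbinomial[symmetric])
    also have "{..max p N} = {..p} \<union> {p<..N}" by auto
    also have "(\<Sum>j\<in>{..p} \<union> {p<..N}. (x gchoose j) * (\<Delta> ^^ j) f (real n)) =
        (\<Sum>j\<le>p. (x gchoose j) * (\<Delta> ^^ j) f (real n))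
        + (\<Sum>j\<in>{p<..N}. (x gchoose j) * (\<Delta> ^^ j) f (real n))"
      by (rule sum.union_disjoint) auto
    finally show ?thesis using newton_nat[of f "real n" N] by (simp add: N)
  qed
  moreover have "(\<lambda>n. \<Sum>j\<in>{p<..N}. (x gchoose j) * (\<Delta> ^^ j) f (real n)) \<longlonglongrightarrow> (\<Sum>j\<in>{p<..N}. 0)"
    by (intro tendsto_sum tendsto_mult_right_zero iterated_diff_tendsto_mono[OF lim]) auto
  ultimately show ?thesis by simp
next
  case False
  obtain N where N: "x < real N" using reals_Archimedean2 by blast
  then have N: "x < real (Suc N)" by simp
  let ?B = "\<lambda>n. \<bar>\<Prod>i<p. x - 1 - real i\<bar> *
    (((\<Delta> ^^ p) f (real n + real (Suc N)) - (\<Delta> ^^ p) f (real n)) / fact p)"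
  have "?B \<longlonglongrightarrow> \<bar>\<Prod>i<p. x - 1 - real i\<bar> * (0 / fact p)"
    by (intro tendsto_mult_left tendsto_divide iterated_diff_increment_tendsto lim) auto
  then have B: "?B \<longlonglongrightarrow> 0" by simp
  have "eventually (\<lambda>n. real n > M) sequentially"
    using filterlim_real_sequentially by (simp add: filterlim_at_top_dense)
  then have "eventually (\<lambda>n. norm (f (real n + x)
      - (\<Sum>j\<le>p. (x gchoose j) * (\<Delta> ^^ j) f (real n))) \<le> ?B n) sequentially"
    by eventually_elim (use newton_remainder_bound[OF conv _ x _ N] False in auto)
  then have "(\<lambda>n. norm (f (real n + x) - (\<Sum>j\<le>p. (x gchoose j) * (\<Delta> ^^ j) f (real n)))) \<longlonglongrightarrow> 0"
    by (intro tendsto_sandwich[OF _ _ tendsto_const B]) auto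
  then show ?thesis by (rule tendsto_norm_zero_cancel)
qed

lemma newton_remainder_tendsto:
  assumes "f \<in> \<K> p" and "(\<lambda>n. (\<Delta> ^^ Suc p) f (real n)) \<longlonglongrightarrow> 0" and "x > 0"
  shows "(\<lambda>n. f (real n + x) - (\<Sum>j\<le>p. (x gchoose j) * (\<Delta> ^^ j) f (real n))) \<longlonglongrightarrow> 0"
proof -
  obtain M where "p_convex_on p {M<..} f \<or> p_convex_on p {M<..} (\<lambda>x. - f x)"
    using assms(1) by (auto simp: asymp_K_def p_concave_on_def)
  then show ?thesis
  proof
    assume "p_convex_on p {M<..} f"
    then show ?thesis using assms by (intro newton_remainder_tendsto_convex)
  next
    assume "p_convex_on p {M<..} (\<lambda>x. - f x)"
    moreover have "(\<lambda>n. (\<Delta> ^^ Suc p) (\<lambda>x. - f x) (real n)) \<longlonglongrightarrow> 0"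
      using tendsto_minus[OF assms(2)] by (simp only: iterated_diff_uminus) simp
    ultimately have "(\<lambda>n. - f (real n + x) - (\<Sum>j\<le>p. (x gchoose j) * (\<Delta> ^^ j) (\<lambda>x. - f x) (real n)))
        \<longlonglongrightarrow> 0"
      using assms(3) by (rule newton_remainder_tendsto_convex)
    from tendsto_minus[OF this] show ?thesis
      by (simp add: iterated_diff_uminus sum_negf)
  qed
qed

section \<open>The approximations of the principal sum\<close>

text \<open>The expression whose limit represents \<open>\<Sigma> g(x)\<close> for \<open>g \<in> \<D> p \<inter> \<K> p\<close>; the index of the binomial
  terms starts at \<open>0\<close> instead of \<open>1\<close>, which avoids the order \<open>j - 1\<close> of the difference.\<close>

definition sum_approx :: "nat \<Rightarrow> (real \<Rightarrow> real) \<Rightarrow> real \<Rightarrow> nat \<Rightarrow> real"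
  where "sum_approx p g x n = (\<Sum>k=1..<n. g (real k)) - (\<Sum>k<n. g (x + real k))
    + (\<Sum>j<p. (x gchoose Suc j) * (\<Delta> ^^ j) g (real n))"

lemma sum_approx_uminus: "sum_approx p (\<lambda>x. - g x) x n = - sum_approx p g x n"
  by (simp add: sum_approx_def iterated_diff_uminus sum_negf)

lemma sum_approx_sum:
  "sum_approx p (\<lambda>x. \<Sum>k\<in>A. g k x) x n = (\<Sum>k\<in>A. sum_approx p (g k) x n)"
  unfolding sum_approx_def iterated_diff_sum sum_distrib_left sum.distrib sum_subtractf
  by (simp only: sum.swap[where A = A])

lemma sum_approx_cong:
  assumes "\<And>t. t > 0 \<Longrightarrow> u t = v t" and "x > 0" "n > 0"
  shows "sum_approx p u x n = sum_approx p v x n"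
  using assms iterated_diff_cong[of u v "real n"] by (simp add: sum_approx_def)

text \<open>The approximation differs from \<open>f x - f 1\<close> by exactly the Newton remainder at \<open>n\<close>.\<close>

lemma sum_approx_diff_tendsto:
  assumes "f \<in> \<K> p" and "(\<lambda>n. (\<Delta> ^^ Suc p) f (real n)) \<longlonglongrightarrow> 0" and "x > 0"
  shows "sum_approx p (\<Delta> f) x \<longlonglongrightarrow> f x - f 1"
proof -
  have eq: "sum_approx p (\<Delta> f) x n = f x - f 1
      - (f (real n + x) - (\<Sum>j\<le>p. (x gchoose j) * (\<Delta> ^^ j) f (real n)))" if "n > 0" for n
  proof -
    have "(\<Sum>k=1..<n. \<Delta> f (real k)) = f (real n) - f 1"
      using that sum_Suc_diff'[of 1 n "\<lambda>k. f (real k)"]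
      by (simp add: forward_diff_def add.commute)
    moreover have "(\<Sum>k<n. \<Delta> f (x + real k)) = f (x + real n) - f x"
      using sum_lessThan_telescope[of "\<lambda>k. f (x + real k)" n]
      by (simp add: forward_diff_def algebra_simps)
    moreover have "(\<Sum>j\<le>p. (x gchoose j) * (\<Delta> ^^ j) f (real n)) =
        f (real n) + (\<Sum>j<p. (x gchoose Suc j) * (\<Delta> ^^ Suc j) f (real n))"
      by (subst lessThan_Suc_atMost[symmetric], subst sum.lessThan_Suc_shift) simp
    ultimately show ?thesis
      by (simp add: sum_approx_def iterated_diff_diff add.commute del: funpow.simps)
  qed
  have "(\<lambda>n. f x - f 1 - (f (real n + x) - (\<Sum>j\<le>p. (x gchoose j) * (\<Delta> ^^ j) f (real n))))
      \<longlonglongrightarrow> f x - f 1 - 0"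
    by (intro tendsto_diff tendsto_const newton_remainder_tendsto[OF assms])
  then have "(\<lambda>n. f x - f 1 - (f (real n + x) - (\<Sum>j\<le>p. (x gchoose j) * (\<Delta> ^^ j) f (real n))))
      \<longlonglongrightarrow> f x - f 1" by simp
  then show ?thesis
    by (rule Lim_transform_eventually)
      (use eventually_gt_at_top[of "0::nat"] in eventually_elim, simp add: eq)
qed

lemma sum_approx_order:
  assumes "g \<in> \<D> p" and "p \<le> q"
  shows "sum_approx q g x \<longlonglongrightarrow> L \<longleftrightarrow> sum_approx p g x \<longlonglongrightarrow> L"
proof -
  have "{..<q} = {..<p} \<union> {p..<q}" using assms(2) by auto
  then have "(\<Sum>j<q. (x gchoose Suc j) * (\<Delta> ^^ j) g (real n)) =
      (\<Sum>j<p. (x gchoose Suc j) * (\<Delta> ^^ j) g (real n))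
      + (\<Sum>j=p..<q. (x gchoose Suc j) * (\<Delta> ^^ j) g (real n))" for n
    by (simp add: sum.union_disjoint ivl_disj_int)
  then have eq: "sum_approx q g x n - sum_approx p g x n =
      (\<Sum>j=p..<q. (x gchoose Suc j) * (\<Delta> ^^ j) g (real n))" for n
    by (simp add: sum_approx_def)
  have "(\<lambda>n. \<Sum>j=p..<q. (x gchoose Suc j) * (\<Delta> ^^ j) g (real n)) \<longlonglongrightarrow> (\<Sum>j=p..<q. 0)"
    using assms(1) unfolding asymp_D_def mem_Collect_eq
    by (intro tendsto_sum tendsto_mult_right_zero) (auto elim: iterated_diff_tendsto_mono)
  then have "(\<lambda>n. sum_approx q g x n - sum_approx p g x n) \<longlonglongrightarrow> 0" by (simp add: eq)
  then show ?thesis by (rule Lim_transform_eq)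
qed

text \<open>Up to terms constant in \<open>x\<close> and a polynomial in \<open>x\<close> of degree at most \<open>p\<close>, which divided
  differences on \<open>p + 2\<close> nodes do not see, the approximation is minus a sum of the functions
  \<open>x \<mapsto> g(x + k)\<close> with \<open>k \<ge> 0\<close>. These are \<open>p\<close>-convex on the same half-line as \<open>g\<close>, whatever \<open>n\<close> is,
  and a pointwise limit preserves the sign of divided differences.\<close>

lemma sum_approx_limit_concave:
  assumes conv: "p_convex_on p {M<..} g" and "M \<ge> 0"
    and lim: "\<And>x. x > 0 \<Longrightarrow> sum_approx p g x \<longlonglongrightarrow> F x"
  shows "p_concave_on p {M<..} F"
  unfolding p_concave_on_def p_convex_on_def
proof (intro allI impI)
  fix S :: "real set" assume "finite S \<and> card S = p + 2 \<and> S \<subseteq> {M<..}"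
  then have S: "finite S" "card S = p + 2" "S \<subseteq> {M<..}" by auto
  have "divided_difference (\<lambda>x. sum_approx p g x n) S \<le> 0" for n
  proof -
    have "divided_difference (\<lambda>x. sum_approx p g x n) S =
        - (\<Sum>k<n. divided_difference g ((\<lambda>x. x + real k) ` S))"
      unfolding sum_approx_def divided_difference_add divided_difference_diff divided_difference_sum
      using S by (simp add: divided_difference_const divided_difference_gchoose
          divided_difference_shift)
    moreover have "divided_difference g ((\<lambda>x. x + real k) ` S) \<ge> 0" for k
    proof -
      have "card ((\<lambda>x. x + real k) ` S) = p + 2" by (subst card_image) (auto simp: S inj_on_def)
      moreover have "(\<lambda>x. x + real k) ` S \<subseteq> {M<..}" using S(3) by auto
      ultimately show ?thesis using conv S(1) unfolding p_convex_on_def by blast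
    qed
    ultimately show ?thesis by (simp add: sum_nonneg)
  qed
  moreover have "(\<lambda>n. divided_difference (\<lambda>x. sum_approx p g x n) S) \<longlonglongrightarrow> divided_difference F S"
    by (intro divided_difference_tendsto lim) (use S(3) \<open>M \<ge> 0\<close> in auto)
  ultimately have "divided_difference F S \<le> 0"
    by (intro LIMSEQ_le_const2) auto
  then show "divided_difference (\<lambda>x. - F x) S \<ge> 0"
    by (simp add: divided_difference_uminus)
qed

lemma sum_approx_limit_K:
  assumes "g \<in> \<K> p" and lim: "\<And>x. x > 0 \<Longrightarrow> sum_approx p g x \<longlonglongrightarrow> F x"
  shows "F \<in> \<K> p"
proof -
  obtain M where M: "M \<ge> 0" and "p_convex_on p {M<..} g \<or> p_convex_on p {M<..} (\<lambda>x. - g x)"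
    using assms(1) by (auto simp: asymp_K_def p_concave_on_def)
  then consider "p_convex_on p {M<..} g" | "p_convex_on p {M<..} (\<lambda>x. - g x)" by blast
  then have "p_convex_on p {M<..} F \<or> p_concave_on p {M<..} F"
  proof cases
    case 1
    then show ?thesis using sum_approx_limit_concave[OF 1 M lim] by simp
  next
    case 2
    have "sum_approx p (\<lambda>x. - g x) x \<longlonglongrightarrow> - F x" if "x > 0" for x
      using tendsto_minus[OF lim[OF that]] by (simp add: sum_approx_uminus[abs_def])
    from sum_approx_limit_concave[OF 2 M this] show ?thesis
      by (simp add: p_concave_on_def)
  qed
  then show ?thesis using M by (auto simp: asymp_K_def)
qed

text \<open>The limit formula determines every solution of \<open>\<Delta> f = g\<close> of the required kind, and two
  orders for the same \<open>g\<close> give the same limit. Conversely, a function that is given by the limit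
  formula is of the required kind by the previous lemma. So the uniqueness part of the theory of
  \<^const>\<open>principal_sum\<close> suffices once convergence is known.\<close>

lemma principal_sum_eqI:
  assumes g: "g \<in> \<D> p" "g \<in> \<K> p"
    and diff: "\<And>x. x > 0 \<Longrightarrow> \<Delta> F x = g x"
    and lim: "\<And>x. x > 0 \<Longrightarrow> sum_approx p g x \<longlonglongrightarrow> F x - F 1"
    and y: "y > 0"
  shows "\<Sigma>\<^sub>+ g y = F y - F 1"
proof -
  define R where "R = restrict (\<lambda>x. F x - F 1) {0<..}"
  have "R \<in> extensional {0<..} \<and> R 1 = 0 \<and> (\<forall>x>0. \<Delta> R x = g x) \<and>
      (\<exists>p. g \<in> \<D> p \<inter> \<K> p \<and> R \<in> \<K> p)"
  proof (intro conjI exI)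
    show "R \<in> \<K> p" by (rule sum_approx_limit_K[OF g(2)]) (simp add: R_def lim)
    show "\<forall>x>0. \<Delta> R x = g x" by (simp add: R_def forward_diff_def flip: diff)
    show "g \<in> \<D> p \<inter> \<K> p" using g by simp
  qed (simp_all add: R_def)
  moreover have "G = R"
    if G: "G \<in> extensional {0<..} \<and> G 1 = 0 \<and> (\<forall>x>0. \<Delta> G x = g x) \<and>
      (\<exists>p. g \<in> \<D> p \<inter> \<K> p \<and> G \<in> \<K> p)" for G
  proof
    fix x
    show "G x = R x"
    proof (cases "x > 0")
      case False
      then show ?thesis using G by (simp add: R_def extensional_def)
    next
      case True
      obtain q where q: "g \<in> \<D> q" "G \<in> \<K> q" using G by auto
      have "(\<lambda>n. (\<Delta> ^^ q) (\<Delta> G) (real n)) \<longlonglongrightarrow> 0"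
        using q(1) unfolding asymp_D_def mem_Collect_eq
        by (rule Lim_transform_eventually)
          (use eventually_gt_at_top[of "0::nat"] in \<open>eventually_elim,
            use G in \<open>intro iterated_diff_cong, auto\<close>\<close>)
      then have "sum_approx q (\<Delta> G) x \<longlonglongrightarrow> G x - G 1"
        using True by (intro sum_approx_diff_tendsto q) (simp_all only: iterated_diff_diff)
      then have "sum_approx q g x \<longlonglongrightarrow> G x - G 1"
        by (rule Lim_transform_eventually)
          (use eventually_gt_at_top[of "0::nat"] in \<open>eventually_elim,
            use G True in \<open>intro sum_approx_cong, auto\<close>\<close>)
      then have "sum_approx (max p q) g x \<longlonglongrightarrow> G x"
        using G sum_approx_order[OF q(1), of "max p q"] by simp
      moreover have "sum_approx (max p q) g x \<longlonglongrightarrow> F x - F 1"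
        using lim[OF True] sum_approx_order[OF g(1), of "max p q"] by simp
      ultimately show ?thesis
        using True LIMSEQ_unique by (fastforce simp: R_def)
    qed
  qed
  ultimately have "\<Sigma>\<^sub>+ g = R" unfolding principal_sum_def by (rule the_equality)
  then show ?thesis using y by (simp add: R_def)
qed

section \<open>Newton's formula with a principal sum as remainder\<close>

text \<open>Pascal's rule turns the forward difference of a summand into a difference of consecutive
  terms in \<open>k\<close>, so that the sum over \<open>k\<close> telescopes.\<close>

lemma diff_newton_terms:
  "\<Delta> (\<lambda>t. \<Sum>k\<le>m. ((x - t + 1) gchoose k) * (\<Delta> ^^ k) f (t + a - 1)) t =
    ((x - t) gchoose m) * (\<Delta> ^^ (m + 1)) f (t + a - 1)"
proof (induction m)
  case 0
  show ?case by (simp add: forward_diff_def algebra_simps)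
next
  case (Suc m)
  have pascal: "((x - t + 1) gchoose Suc m) = ((x - t) gchoose m) + ((x - t) gchoose Suc m)"
    using gbinomial_Suc_Suc[of "x - t" m] by simp
  have "(\<Delta> ^^ (Suc m + 1)) f (t + a - 1) =
      (\<Delta> ^^ Suc m) f (t + a) - (\<Delta> ^^ Suc m) f (t + a - 1)"
    using iterated_diff_Suc[of "Suc m" f "t + a - 1"] by simp
  moreover have "x - (t + 1) + 1 = x - t" "t + 1 + a - 1 = t + a" by simp_all
  ultimately have "\<Delta> (\<lambda>t. ((x - t + 1) gchoose Suc m) * (\<Delta> ^^ Suc m) f (t + a - 1)) t =
      ((x - t) gchoose Suc m) * (\<Delta> ^^ (Suc m + 1)) f (t + a - 1)
      - ((x - t) gchoose m) * (\<Delta> ^^ (m + 1)) f (t + a - 1)"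
    unfolding forward_diff_def[of "\<lambda>t. _ t * _ t"] pascal
    by (simp only: Suc_eq_plus1) (simp add: algebra_simps del: funpow.simps)
  then show ?case
    unfolding sum.atMost_Suc diff_add Suc.IH by simp
qed

theorem theorem7p2:
  fixes f :: "real \<Rightarrow> real" and a x :: real and m :: nat
  assumes "a > 0" and "x \<ge> 0"
    and "\<And>k. k \<le> m \<Longrightarrow>
      (\<lambda>t. ((x - t) gchoose k) * (\<Delta> ^^ (k + 1)) f (t + a - 1)) \<in> dom_\<Sigma>"
    and "\<And>k. k \<le> m \<Longrightarrow>
      \<exists>p\<ge>1. (\<lambda>t. ((x - t + 1) gchoose k) * (\<Delta> ^^ k) f (t + a - 1)) \<in> \<D> p \<inter> \<K> p"
  shows "f (x + a) = (\<Sum>j=0..m. (x gchoose j) * (\<Delta> ^^ j) f a) +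
    \<Sigma>\<^sub>+ (\<lambda>t. ((x - t) gchoose m) * (\<Delta> ^^ (m + 1)) f (t + a - 1)) (x + 1)"
proof -
  define h where "h k t = ((x - t + 1) gchoose k) * (\<Delta> ^^ k) f (t + a - 1)" for k t
  define g where "g = (\<lambda>t. ((x - t) gchoose m) * (\<Delta> ^^ (m + 1)) f (t + a - 1))"
  define H where "H t = (\<Sum>k\<le>m. h k t)" for t
  have diff_H: "\<Delta> H = g"
    unfolding H_def h_def g_def by (rule ext) (rule diff_newton_terms)
  have diff_H_sum: "\<Delta> H = (\<lambda>t. \<Sum>k\<le>m. \<Delta> (h k) t)"
    by (rule ext) (simp add: H_def forward_diff_def sum_subtractf)
  obtain p where p: "g \<in> \<D> p" "g \<in> \<K> p"
    using assms(3)[of m] unfolding g_def dom_Sigma_def by auto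
  have "\<forall>k\<in>{..m}. \<exists>p. h k \<in> \<D> p \<inter> \<K> p"
    using assms(4) unfolding h_def by blast
  then obtain q where q: "\<And>k. k \<le> m \<Longrightarrow> h k \<in> \<D> (q k) \<inter> \<K> (q k)"
    by (metis atMost_iff)
  \<comment> \<open>One order for all summands: the orders of the terms may differ from each other and from
    that of \<open>g\<close>, and the approximations are additive only for a common order.\<close>
  define P where "P = p + (\<Sum>k\<le>m. q k)"
  have "sum_approx P (\<Delta> (h k)) y \<longlonglongrightarrow> h k y - h k 1" if "k \<le> m" "y > 0" for k y
  proof -
    have lim: "(\<lambda>n. (\<Delta> ^^ Suc (q k)) (h k) (real n)) \<longlonglongrightarrow> 0"
      using q[OF that(1)] iterated_diff_tendsto_mono[of "q k" "h k" "Suc (q k)"]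
      by (simp add: asymp_D_def)
    then have "\<Delta> (h k) \<in> \<D> (q k)" by (simp add: asymp_D_def iterated_diff_diff del: funpow.simps)
    moreover have "q k \<le> P"
      using member_le_sum[of k "{..m}" q] that(1) by (simp add: P_def)
    moreover have "sum_approx (q k) (\<Delta> (h k)) y \<longlonglongrightarrow> h k y - h k 1"
      by (rule sum_approx_diff_tendsto) (use q[OF that(1)] lim that(2) in auto)
    ultimately show ?thesis using sum_approx_order by blast
  qed
  then have "sum_approx P g y \<longlonglongrightarrow> H y - H 1" if "y > 0" for y
    using that unfolding diff_H[symmetric] diff_H_sum sum_approx_sum[abs_def]
    unfolding H_def sum_subtractf[symmetric] by (intro tendsto_sum) auto
  then have lim: "sum_approx p g y \<longlonglongrightarrow> H y - H 1" if "y > 0" for y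
    using that sum_approx_order[OF p(1), of P] by (simp add: P_def)
  have "\<Sigma>\<^sub>+ g (x + 1) = H (x + 1) - H 1"
    by (rule principal_sum_eqI[OF p _ lim]) (use assms(2) in \<open>simp_all add: diff_H\<close>)
  moreover have "H (x + 1) = f (x + a)"
  proof -
    have "h k (x + 1) = (if k = 0 then f (x + a) else 0)" for k
      by (cases k) (simp_all add: h_def)
    then show ?thesis by (simp add: H_def)
  qed
  moreover have "H 1 = (\<Sum>j=0..m. (x gchoose j) * (\<Delta> ^^ j) f a)"
    by (simp add: H_def h_def atLeast0AtMost)
  ultimately show ?thesis by (simp add: g_def)
qed

end
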